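(* Let $X=[0,1]$, $\Sigma=[-1,1]$ and let the true distribution $P$ be the uniform distribution on $\Sigma$. (i) For every $r>0$ there exists a loss function $\ell_r:X\times\Sigma\to\mathbb{R}$, jointly continuous on $X\times\Sigma$, such that, with $c$ and $\hat c_{\mathrm{KL},r}$ defined through the loss $\ell_r$, for every sample size $N\ge1$, $$\mathrm{Prob}\left[\exists x\in X\text{ such that }c(x,P)>\hat c_{\mathrm{KL},r}(x,P_N)\right]=1 .$$ (ii) There exists a loss function $\ell:X\times\Sigma\to\mathbb{R}$, jointly continuous on $X\times\Sigma$, such that, with $c$ and $\hat c_{\mathrm{KL},r}$ defined through $\ell$, for every $0<r<\log 2$ and every $N\ge1$, $$\mathrm{Prob}\left[c(\hat x_r(P_N),P)>\hat c_{\mathrm{KL},r}(\hat x_r(P_N),P_N)\right]=1$$ and $$\mathrm{Prob}\left[\min_{x\in X}c(x,P)>\min_{x\in X}\hat c_{\mathrm{KL},r}(x,P_N)\right]=1,$$ where $\hat x_r(P_N)\in\arg\min_{x\in X}\hat c_{\mathrm{KL},r}(x,P_N)$.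
   Context: $\mathcal{P}(\Sigma)$ is the set of Borel probability measures on $\Sigma$. For a loss $\ell$, $c(x,Q):=\int\ell(x,\xi)\,\mathrm{d}Q(\xi)$. $\xi_1,\dots,\xi_N$ are i.i.d. samples from $P$, $P_N:=\frac1N\sum_{i=1}^N\delta_{\xi_i}$, and $\mathrm{Prob}$ is the probability under this sampling. KL divergence (convention on the order of arguments): $D_{\mathrm{KL}}(P',Q)=\int\log\frac{\mathrm{d}P'}{\mathrm{d}Q}\,\mathrm{d}P'$ if $P'\ll Q$ and $+\infty$ otherwise. KL-DRO predictor: $\hat c_{\mathrm{KL},r}(x,\hat P):=\sup\{c(x,Q):Q\in\mathcal{P}(\Sigma),\ D_{\mathrm{KL}}(\hat P,Q)\le r\}$; in particular $Q$ may put mass outside the support of $\hat P$. *)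

theory Defs
  imports "HOL-Probability.Probability"
begin

definition X :: "real set" where
  "X = {0..1}"

definition Sigma_set :: "real set" where
  "Sigma_set = {-1..1}"

text \<open>
  Probability measures on \<open>\<Sigma>\<close> live on the measurable space \<open>\<Sigma>\<close> itself, with its
  Borel sigma-algebra, so that \<open>space (prob_algebra borel_Sigma)\<close> is \<open>\<P>(\<Sigma>)\<close>.
\<close>

definition borel_Sigma :: "real measure" where
  "borel_Sigma = restrict_space borel Sigma_set"

definition P :: "real measure" where
  "P = uniform_measure (restrict_space lborel Sigma_set) Sigma_set"

definition sample_space :: "nat \<Rightarrow> (nat \<Rightarrow> real) measure" where
  "sample_space N = PiM {1..N} (\<lambda>_. P)"

text \<open>
  The law of \<open>\<xi> i\<close> for \<open>i\<close> drawn uniformly from \<open>{1..N}\<close>; the lemma \<open>emeasure_empirical\<close>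
  below is the equation \<open>P\<^sub>N = 1/N (\<delta>\<^bsub>\<xi> 1\<^esub> + ... + \<delta>\<^bsub>\<xi> N\<^esub>)\<close>.
\<close>

definition empirical :: "nat \<Rightarrow> (nat \<Rightarrow> real) \<Rightarrow> real measure" where
  "empirical N \<xi> = distr (uniform_count_measure {1..N}) borel_Sigma \<xi>"

definition cost :: "(real \<Rightarrow> real \<Rightarrow> real) \<Rightarrow> real \<Rightarrow> real measure \<Rightarrow> real" where
  "cost l x Q = (\<integral>\<xi>. l x \<xi> \<partial>Q)"

text \<open>
  The library's \<open>KL_divergence b Q P'\<close> is the Bochner integral of \<open>log b (dP'/dQ)\<close> with respect to
  its second measure argument \<open>P'\<close>, hence real valued and \<open>0\<close> if the integrand is not integrable.
  For probability measures \<open>P' \<lless> Q\<close> the negative part of the integrand is always integrable, so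
  non-integrability means that the integral is \<open>+\<infinity>\<close>.
\<close>

definition D_KL :: "'a measure \<Rightarrow> 'a measure \<Rightarrow> ereal" where
  "D_KL P' Q =
     (if absolutely_continuous Q P' \<and> integrable P' (entropy_density (exp 1) Q P')
      then ereal (KL_divergence (exp 1) Q P') else \<infinity>)"

definition ambiguity_set :: "real \<Rightarrow> real measure \<Rightarrow> real measure set" where
  "ambiguity_set r Phat = {Q \<in> space (prob_algebra borel_Sigma). D_KL Phat Q \<le> ereal r}"

text \<open>
  For continuous \<open>l\<close>, \<open>x \<in> X\<close> and \<open>r \<ge> 0\<close> this is the supremum of a nonempty bounded set, see
  \<open>self_in_ambiguity_set\<close> and \<open>bdd_above_costs\<close>.
\<close>

definition cost_KL :: "(real \<Rightarrow> real \<Rightarrow> real) \<Rightarrow> real \<Rightarrow> real \<Rightarrow> real measure \<Rightarrow> real" where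
  "cost_KL l r x Phat = (SUP Q \<in> ambiguity_set r Phat. cost l x Q)"

definition continuous_loss :: "(real \<Rightarrow> real \<Rightarrow> real) \<Rightarrow> bool" where
  "continuous_loss l \<longleftrightarrow> continuous_on (X \<times> Sigma_set) (\<lambda>(x, \<xi>). l x \<xi>)"

lemma Sigma_set_borel: "Sigma_set \<in> sets borel"
  by (simp add: Sigma_set_def)

lemma space_borel_Sigma: "space borel_Sigma = Sigma_set"
  by (simp add: borel_Sigma_def space_restrict_space)

lemma P_in_prob_algebra: "P \<in> space (prob_algebra borel_Sigma)"
proof -
  let ?M = "restrict_space lborel Sigma_set"
  have "emeasure ?M Sigma_set = ennreal 2"
    by (simp add: emeasure_restrict_space Sigma_set_def)
  then have "prob_space P"
    unfolding P_def by (intro prob_space_uniform_measure) auto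
  moreover have "sets P = sets borel_Sigma"
    by (simp add: P_def borel_Sigma_def sets_restrict_space)
  ultimately show ?thesis
    by (simp add: space_prob_algebra)
qed

lemma space_sample_space: "space (sample_space N) = PiE {1..N} (\<lambda>_. Sigma_set)"
  by (simp add: sample_space_def space_PiM P_def space_restrict_space)

lemma empirical_measurable:
  assumes "\<xi> \<in> space (sample_space N)"
  shows "\<xi> \<in> measurable (uniform_count_measure {1..N}) borel_Sigma"
  using assms
  by (auto simp: measurable_def space_uniform_count_measure sets_uniform_count_measure
      space_sample_space space_borel_Sigma)

lemma emeasure_empirical:
  assumes "1 \<le> N" "\<xi> \<in> space (sample_space N)" "A \<in> sets borel_Sigma"
  shows "emeasure (empirical N \<xi>) A =
    ennreal (1 / real N) * (\<Sum>i = 1..N. emeasure (return borel_Sigma (\<xi> i)) A)"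
proof -
  have "emeasure (empirical N \<xi>) A =
      emeasure (uniform_count_measure {1..N}) {i \<in> {1..N}. \<xi> i \<in> A}"
    unfolding empirical_def
    by (subst emeasure_distr[OF empirical_measurable[OF assms(2)] assms(3)])
      (auto simp: space_uniform_count_measure intro!: arg_cong2[where f = emeasure])
  also have "\<dots> = ennreal (1 / real N * real (card {i \<in> {1..N}. \<xi> i \<in> A}))"
    by (subst emeasure_uniform_count_measure) auto
  also have "\<dots> = ennreal (1 / real N) * (\<Sum>i = 1..N. indicator A (\<xi> i))"
  proof -
    have "(\<Sum>i = 1..N. indicator A (\<xi> i) :: ennreal) = of_nat (card {i \<in> {1..N}. \<xi> i \<in> A})"
      by (simp add: indicator_def if_distrib sum.If_cases Int_def)
    then show ?thesis
      by (simp only:) (simp add: ennreal_of_nat_eq_real_of_nat flip: ennreal_mult)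
  qed
  finally show ?thesis
    using assms(3) by simp
qed

lemma empirical_in_prob_algebra:
  assumes "1 \<le> N" "\<xi> \<in> space (sample_space N)"
  shows "empirical N \<xi> \<in> space (prob_algebra borel_Sigma)"
proof -
  interpret U: prob_space "uniform_count_measure {1..N}"
    by (rule prob_space_uniform_count_measure) (use assms(1) in auto)
  show ?thesis
    using U.prob_space_distr[OF empirical_measurable[OF assms(2)]]
    by (simp add: empirical_def space_prob_algebra)
qed

lemma self_in_ambiguity_set:
  assumes "Phat \<in> space (prob_algebra borel_Sigma)" "0 \<le> r"
  shows "Phat \<in> ambiguity_set r Phat"
proof -
  interpret prob_space Phat
    using assms(1) by (simp add: space_prob_algebra)
  have "AE x in Phat. 1 = RN_deriv Phat Phat x"
    by (rule RN_deriv_unique) (auto simp: density_1)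
  then have "AE x in Phat. entropy_density (exp 1) Phat Phat x = 0"
    by eventually_elim (simp add: entropy_density_def flip: one_ennreal_def)
  then have "integrable Phat (entropy_density (exp 1) Phat Phat)"
    by (subst integrable_cong_AE[where g = "\<lambda>_. 0"]) auto
  then have "D_KL Phat Phat = 0"
    by (simp add: D_KL_def KL_same_eq_0 absolutely_continuous_def)
  then show ?thesis
    using assms by (simp add: ambiguity_set_def)
qed

lemma continuous_loss_section:
  assumes "continuous_loss l" "x \<in> X"
  shows "continuous_on Sigma_set (l x)"
proof -
  have "continuous_on Sigma_set ((\<lambda>(x, \<xi>). l x \<xi>) \<circ> (\<lambda>\<xi>. (x, \<xi>)))"
    by (intro continuous_on_compose continuous_intros
        continuous_on_subset[OF assms(1)[unfolded continuous_loss_def]])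
      (use assms(2) in auto)
  then show ?thesis
    by (simp add: comp_def)
qed

lemma integrable_loss:
  assumes "continuous_loss l" "x \<in> X" "Q \<in> space (prob_algebra borel_Sigma)"
  shows "integrable Q (l x)"
proof -
  interpret prob_space Q
    using assms(3) by (simp add: space_prob_algebra)
  have sets: "sets Q = sets borel_Sigma"
    using assms(3) by (simp add: space_prob_algebra)
  have c: "continuous_on Sigma_set (l x)"
    by (rule continuous_loss_section) fact+
  then have "bounded (l x ` Sigma_set)"
    by (intro compact_imp_bounded compact_continuous_image) (auto simp: Sigma_set_def)
  then obtain B where B: "\<And>\<xi>. \<xi> \<in> Sigma_set \<Longrightarrow> norm (l x \<xi>) \<le> B"
    by (auto simp: bounded_iff)
  have "l x \<in> borel_measurable borel_Sigma"
    unfolding borel_Sigma_def by (rule borel_measurable_continuous_on_restrict) fact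
  then have "l x \<in> borel_measurable Q"
    by (simp add: measurable_cong_sets[OF sets refl])
  moreover have "space Q = Sigma_set"
    using sets_eq_imp_space_eq[OF sets] by (simp add: space_borel_Sigma)
  ultimately show ?thesis
    by (intro integrable_const_bound[where B = B] AE_I2) (simp_all only: B)
qed

lemma cost_diff_le:
  assumes "continuous_loss l" "x \<in> X" "y \<in> X" "Q \<in> space (prob_algebra borel_Sigma)"
    and "\<And>\<xi>. \<xi> \<in> Sigma_set \<Longrightarrow> l x \<xi> \<le> l y \<xi> + e"
  shows "cost l x Q \<le> cost l y Q + e"
proof -
  interpret prob_space Q
    using assms(4) by (simp add: space_prob_algebra)
  have "space Q = Sigma_set"
    using assms(4) sets_eq_imp_space_eq[of Q borel_Sigma]
    by (simp add: space_prob_algebra space_borel_Sigma)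
  then have "(\<integral>\<xi>. l x \<xi> \<partial>Q) \<le> (\<integral>\<xi>. l y \<xi> + e \<partial>Q)"
    using integrable_loss[OF assms(1,2,4)] integrable_loss[OF assms(1,3,4)] assms(5)
    by (intro integral_mono) auto
  also have "\<dots> = (\<integral>\<xi>. l y \<xi> \<partial>Q) + e"
    by (subst Bochner_Integration.integral_add)
      (use assms in \<open>auto intro: integrable_loss simp: prob_space\<close>)
  finally show ?thesis
    by (simp add: cost_def)
qed

lemma bdd_above_costs:
  assumes "continuous_loss l" "x \<in> X"
  shows "bdd_above ((\<lambda>Q. cost l x Q) ` ambiguity_set r Phat)"
proof -
  have "bounded (l x ` Sigma_set)"
    using continuous_loss_section[OF assms]
    by (intro compact_imp_bounded compact_continuous_image) (auto simp: Sigma_set_def)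
  then obtain B where B: "\<And>\<xi>. \<xi> \<in> Sigma_set \<Longrightarrow> norm (l x \<xi>) \<le> B"
    by (auto simp: bounded_iff)
  have "cost l x Q \<le> B" if "Q \<in> ambiguity_set r Phat" for Q
  proof -
    have Q: "Q \<in> space (prob_algebra borel_Sigma)"
      using that by (simp add: ambiguity_set_def)
    interpret prob_space Q
      using Q by (simp add: space_prob_algebra)
    have "space Q = Sigma_set"
      using Q sets_eq_imp_space_eq[of Q borel_Sigma]
      by (simp add: space_prob_algebra space_borel_Sigma)
    then have "(\<integral>\<xi>. l x \<xi> \<partial>Q) \<le> B"
      by (intro integral_le_const integrable_loss assms Q)
        (auto intro!: AE_I2 order_trans[OF _ B])
    then show ?thesis
      by (simp add: cost_def)
  qed
  then show ?thesis
    by (auto simp: bdd_above_def)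
qed

lemma continuous_loss_equicontinuous:
  assumes "continuous_loss l" "0 < e"
  shows "\<exists>d>0. \<forall>x\<in>X. \<forall>y\<in>X. \<forall>\<xi>\<in>Sigma_set. dist x y < d \<longrightarrow> l x \<xi> \<le> l y \<xi> + e"
proof -
  have "compact (X \<times> Sigma_set)"
    by (intro compact_Times) (auto simp: X_def Sigma_set_def)
  then have "uniformly_continuous_on (X \<times> Sigma_set) (\<lambda>(x, \<xi>). l x \<xi>)"
    using assms(1) by (intro compact_uniformly_continuous) (auto simp: continuous_loss_def)
  then obtain d where d: "0 < d"
    "\<And>p q. p \<in> X \<times> Sigma_set \<Longrightarrow> q \<in> X \<times> Sigma_set \<Longrightarrow> dist q p < d \<Longrightarrow>
      dist (case q of (x, \<xi>) \<Rightarrow> l x \<xi>) (case p of (x, \<xi>) \<Rightarrow> l x \<xi>) < e"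
    using assms(2) unfolding uniformly_continuous_on_def by meson
  have "l x \<xi> \<le> l y \<xi> + e"
    if "x \<in> X" "y \<in> X" "\<xi> \<in> Sigma_set" "dist x y < d" for x y \<xi>
    using d(2)[of "(y, \<xi>)" "(x, \<xi>)"] that by (auto simp: dist_Pair_Pair dist_real_def)
  with d(1) show ?thesis
    by blast
qed

lemma ex_is_arg_min:
  fixes f :: "real \<Rightarrow> real"
  assumes "\<And>e. 0 < e \<Longrightarrow> \<exists>d>0. \<forall>x\<in>X. \<forall>y\<in>X. dist x y < d \<longrightarrow> f x \<le> f y + e"
  shows "\<exists>x. is_arg_min f (\<lambda>x. x \<in> X) x \<and> f x = (INF y \<in> X. f y)"
proof -
  have "continuous_on X f"
    unfolding continuous_on_iff
  proof (intro ballI allI impI)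
    fix x e :: real
    assume x: "x \<in> X" and e: "0 < e"
    obtain d where d: "0 < d" "\<And>x y. x \<in> X \<Longrightarrow> y \<in> X \<Longrightarrow> dist x y < d \<Longrightarrow> f x \<le> f y + e / 2"
      using assms[of "e / 2"] e by (auto simp: Ball_def)
    have "dist (f y) (f x) < e" if "y \<in> X" "dist y x < d" for y
    proof -
      have "f x \<le> f y + e / 2" "f y \<le> f x + e / 2"
        using d(2) x that by (auto simp: dist_commute)
      then show ?thesis
        using e by (simp add: dist_real_def abs_less_iff)
    qed
    with d(1) show "\<exists>d>0. \<forall>y\<in>X. dist y x < d \<longrightarrow> dist (f y) (f x) < e"
      by blast
  qed
  then obtain x where x: "x \<in> X" "\<And>y. y \<in> X \<Longrightarrow> f x \<le> f y"
    using continuous_attains_inf[of X f] by (auto simp: X_def)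
  have "f x = (INF y \<in> X. f y)"
    by (rule sym, rule cInf_eq_minimum) (use x in auto)
  with x show ?thesis
    by (auto simp: is_arg_min_def not_less)
qed

text \<open>Both minima over \<open>X\<close> are attained, and equal to the infima.\<close>

lemma ex_is_arg_min_cost:
  assumes "continuous_loss l" "Q \<in> space (prob_algebra borel_Sigma)"
  shows "\<exists>x. is_arg_min (\<lambda>x. cost l x Q) (\<lambda>x. x \<in> X) x \<and> cost l x Q = (INF y \<in> X. cost l y Q)"
proof (rule ex_is_arg_min)
  fix e :: real
  assume "0 < e"
  then obtain d where d: "0 < d"
    "\<And>x y \<xi>. x \<in> X \<Longrightarrow> y \<in> X \<Longrightarrow> \<xi> \<in> Sigma_set \<Longrightarrow> dist x y < d \<Longrightarrow> l x \<xi> \<le> l y \<xi> + e"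
    using continuous_loss_equicontinuous[OF assms(1)] by metis
  have "cost l x Q \<le> cost l y Q + e" if "x \<in> X" "y \<in> X" "dist x y < d" for x y
    by (intro cost_diff_le assms that d)
  with d(1) show "\<exists>d>0. \<forall>x\<in>X. \<forall>y\<in>X. dist x y < d \<longrightarrow> cost l x Q \<le> cost l y Q + e"
    by blast
qed

lemma ex_is_arg_min_cost_KL:
  assumes "continuous_loss l" "Phat \<in> space (prob_algebra borel_Sigma)" "0 \<le> r"
  shows "\<exists>x. is_arg_min (\<lambda>x. cost_KL l r x Phat) (\<lambda>x. x \<in> X) x \<and>
    cost_KL l r x Phat = (INF y \<in> X. cost_KL l r y Phat)"
proof (rule ex_is_arg_min)
  fix e :: real
  assume "0 < e"
  then obtain d where d: "0 < d"
    "\<And>x y \<xi>. x \<in> X \<Longrightarrow> y \<in> X \<Longrightarrow> \<xi> \<in> Sigma_set \<Longrightarrow> dist x y < d \<Longrightarrow> l x \<xi> \<le> l y \<xi> + e"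
    using continuous_loss_equicontinuous[OF assms(1)] by metis
  have "cost_KL l r x Phat \<le> cost_KL l r y Phat + e"
    if xy: "x \<in> X" "y \<in> X" "dist x y < d" for x y
    unfolding cost_KL_def
  proof (rule cSUP_least)
    show "ambiguity_set r Phat \<noteq> {}"
      using self_in_ambiguity_set[OF assms(2,3)] by auto
    fix Q
    assume Q: "Q \<in> ambiguity_set r Phat"
    then have "cost l x Q \<le> cost l y Q + e"
      by (intro cost_diff_le assms xy d) (simp_all add: ambiguity_set_def xy)
    also have "cost l y Q \<le> (SUP Q \<in> ambiguity_set r Phat. cost l y Q)"
      using Q by (intro cSUP_upper bdd_above_costs assms xy)
    finally show "cost l x Q \<le> (SUP Q \<in> ambiguity_set r Phat. cost l y Q) + e"
      by simp
  qed
  with d(1) show "\<exists>d>0. \<forall>x\<in>X. \<forall>y\<in>X. dist x y < d \<longrightarrow>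
      cost_KL l r x Phat \<le> cost_KL l r y Phat + e"
    by blast
qed

end

theory Submission
  imports Defs
begin

text \<open>
  If \<open>D_KL M Q \<le> r\<close> and \<open>M\<close> is concentrated on \<open>A\<close>, then \<open>Q A \<ge> exp (- r)\<close>. So at an \<open>x\<close> where
  \<open>0 \<le> l x \<le> b\<close> and \<open>l x\<close> vanishes at every sample point, the predictor is at most \<open>b (1 - exp (- r))\<close>.
  Take \<open>l x \<xi> = x h (\<xi> / x)\<close>, where \<open>h\<close> is \<open>1\<close>-periodic, vanishes near the integers, and is \<open>1\<close>
  outside a slightly larger neighbourhood of them, so that its mean exceeds \<open>1 - exp (- r)\<close>. By
  simultaneous Dirichlet approximation some positive integer \<open>q\<close> brings all multiples \<open>q \<xi> i\<close> close
  to integers, whatever the sample is, and then \<open>x = 1 / q\<close> is disappointing. This proves (i).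

  For (ii), subtract the true cost: then the true cost is identically \<open>0\<close> while the predictor is
  negative somewhere, hence at each of its minimizers. One \<open>h\<close> suffices for all \<open>r < ln 2\<close>, since
  \<open>1 - exp (- r) < 1/2\<close>. All the events in question are in fact the whole sample space.
\<close>

section \<open>Mass forced by a Kullback-Leibler bound\<close>

text \<open>With \<open>f\<close> the density of \<open>M\<close> with respect to \<open>Q\<close>,
  the integral of \<open>1 / f\<close> over \<open>A\<close> against \<open>M\<close> is at most
  \<open>measure Q A\<close>. Jensen for \<open>ln\<close> then bounds
  \<open>- ln (measure Q A)\<close> by the integral of \<open>ln f\<close>, which is the divergence;
  the tangent inequality \<open>ln_le_minus_one\<close> takes the place of Jensen.\<close>

lemma exp_neg_le_measure_of_D_KL_le:
  assumes "prob_space M" "prob_space Q" "sets M = sets Q"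
    and D: "D_KL M Q \<le> ereal r" and A: "A \<in> sets Q" "measure M A = 1"
  shows "exp (- r) \<le> measure Q A"
proof -
  interpret M: prob_space M by fact
  interpret Q: prob_space Q by fact
  have ac: "absolutely_continuous Q M" and int: "integrable M (entropy_density (exp 1) Q M)"
    and KL: "KL_divergence (exp 1) Q M \<le> r"
    using D by (auto simp: D_KL_def split: if_splits)
  obtain f where f: "f \<in> borel_measurable Q" "AE x in Q. RN_deriv Q M x = ennreal (f x)"
      "AE x in M. 0 < f x" "\<And>x. 0 \<le> f x"
    using Q.real_RN_deriv[OF M.finite_measure_axioms ac assms(3)] by metis
  have M_eq: "M = density Q f"
  proof -
    have "M = density Q (RN_deriv Q M)"
      using Q.density_RN_deriv[OF ac assms(3)] by simp
    also have "\<dots> = density Q f"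
      using f(1,2) by (intro density_cong) auto
    finally show ?thesis .
  qed
  have fM: "f \<in> borel_measurable M"
    using f(1) measurable_cong_sets[OF assms(3) refl] by blast
  \<comment> \<open>The identity between \<open>f\<close> and \<open>RN_deriv\<close> holds almost
    everywhere for \<open>Q\<close>; absolute continuity carries it over to
    \<open>M\<close>.\<close>
  have "AE x in M. entropy_density (exp 1) Q M x = ln (f x)"
    using absolutely_continuous_AE[OF assms(3) ac f(2)] f(3)
    by eventually_elim (simp add: entropy_density_def log_ln)
  then have AE_ln: "AE x in M. ln (f x) = entropy_density (exp 1) Q M x"
    by eventually_elim simp
  have meas: "(\<lambda>x. ln (f x)) \<in> borel_measurable M" "entropy_density (exp 1) Q M \<in> borel_measurable M"
    using fM borel_measurable_integrable[OF int] by auto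
  have ln_int: "integrable M (\<lambda>x. ln (f x))"
    using integrable_cong_AE[OF meas AE_ln] int by simp
  have ln_KL: "(\<integral>x. ln (f x) \<partial>M) \<le> r"
    using integral_cong_AE[OF meas AE_ln] KL by (simp add: KL_divergence_def)
  have "measure Q A \<noteq> 0"
  proof
    assume "measure Q A = 0"
    then have "A \<in> null_sets Q"
      using A(1) Q.emeasure_eq_measure[of A] by auto
    then have "A \<in> null_sets M"
      using ac by (auto simp: absolutely_continuous_def)
    then have "measure M A = 0"
      by (simp add: measure_def null_setsD1)
    with A(2) show False by simp
  qed
  then have pos: "0 < measure Q A"
    by (simp add: less_le)
  have AM: "A \<in> sets M"
    using A(1) assms(3) by simp
  have ind_int: "integrable M (\<lambda>x. indicator A x / f x)"
      and ind_le: "(\<integral>x. indicator A x / f x \<partial>M) \<le> measure Q A"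
  proof -
    \<comment> \<open>This product is the indicator of \<open>A\<close> where
      \<open>f x > 0\<close>. Where \<open>f x = 0\<close> it vanishes, since division by 0 gives 0;
      hence the bound 1 below, and an inequality rather than an equality with
      \<open>measure Q A\<close>.\<close>
    have m: "(\<lambda>x. f x *\<^sub>R (indicator A x / f x)) \<in> borel_measurable Q"
      "(\<lambda>x. indicator A x / f x) \<in> borel_measurable Q"
      using f(1) A(1) by measurable
    have int: "integrable Q (\<lambda>x. f x *\<^sub>R (indicator A x / f x))"
      by (rule Q.integrable_const_bound[where B = 1]) (use m in \<open>auto simp: indicator_def\<close>)
    then show "integrable M (\<lambda>x. indicator A x / f x)"
      unfolding M_eq using m f by (subst integrable_density) auto
    have "(\<integral>x. indicator A x / f x \<partial>M) = (\<integral>x. f x *\<^sub>R (indicator A x / f x) \<partial>Q)"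
      unfolding M_eq using m f by (subst integral_density) auto
    also have "\<dots> \<le> (\<integral>x. indicator A x \<partial>Q)"
    proof (rule integral_mono[OF int])
      show "integrable Q (indicator A :: _ \<Rightarrow> real)"
        using A(1) by (intro integrable_real_indicator) (auto simp: Q.emeasure_eq_measure)
    qed (auto simp: indicator_def)
    finally show "(\<integral>x. indicator A x / f x \<partial>M) \<le> measure Q A"
      using A(1) by simp
  qed
  have AEA: "AE x in M. x \<in> A"
    using A(2) AM by (simp add: M.prob_eq_1)
  \<comment> \<open>Integrate \<open>ln a \<le> ln (f x) + a / f x - 1\<close> over \<open>A\<close>; this \<open>a\<close> is the optimal choice.\<close>
  define a where "a = 1 / measure Q A"
  have a: "0 < a" "a * measure Q A = 1"
    using pos by (simp_all add: a_def)
  have "ln a = (\<integral>x. ln a \<partial>M)"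
    using M.prob_space by simp
  also have "\<dots> \<le> (\<integral>x. ln (f x) + a * (indicator A x / f x) - 1 \<partial>M)"
  proof (rule integral_mono_AE)
    show "AE x in M. ln a \<le> ln (f x) + a * (indicator A x / f x) - 1"
      using AEA f(3)
    proof eventually_elim
      case (elim x)
      have "ln (a / f x) \<le> a / f x - 1"
        using a elim by (intro ln_le_minus_one) simp
      then show ?case
        using a elim by (simp add: ln_div)
    qed
  qed (use ln_int ind_int in \<open>auto simp del: times_divide_eq_right\<close>)
  also have "\<dots> = (\<integral>x. ln (f x) \<partial>M) + a * (\<integral>x. indicator A x / f x \<partial>M) - 1"
    using ln_int ind_int M.prob_space by (simp del: times_divide_eq_right)
  also have "\<dots> \<le> r + a * measure Q A - 1"
    using ln_KL ind_le a(1) by (intro diff_right_mono add_mono mult_left_mono) auto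
  finally have "- ln (measure Q A) \<le> r"
    using a pos by (simp add: a_def ln_div)
  then show ?thesis
    using pos by (metis exp_le_cancel_iff exp_ln minus_le_iff)
qed

section \<open>The loss and its joint continuity\<close>

text \<open>The function \<open>h\<close> of the proof idea. For \<open>K > 0\<close> it is 0 up to
  distance \<open>1 / K\<close> from the integers, then grows linearly, and is 1 from distance
  \<open>2 / K\<close> on.\<close>

definition clamped_dist :: "nat \<Rightarrow> real \<Rightarrow> real" where
  "clamped_dist K t = min 1 (max 0 (real K * infdist t \<int> - 1))"

text \<open>At \<open>x = 1 / q\<close> this is \<open>h (q * \<xi>) / q\<close>. The factor
  \<open>x\<close> damps the ever faster oscillation as \<open>x\<close> tends to 0.\<close>

definition loss :: "nat \<Rightarrow> real \<Rightarrow> real \<Rightarrow> real" where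
  "loss K x \<xi> = x * clamped_dist K (\<xi> / x)"

lemma clamped_dist_nonneg: "0 \<le> clamped_dist K t"
  and clamped_dist_le_1: "clamped_dist K t \<le> 1"
  by (auto simp: clamped_dist_def)

lemma continuous_on_clamped_dist: "continuous_on S (clamped_dist K)"
  unfolding clamped_dist_def by (intro continuous_intros)

lemma clamped_dist_eq_0:
  assumes "\<bar>t - of_int p\<bar> \<le> 1 / real K"
  shows "clamped_dist K t = 0"
proof -
  have "infdist t \<int> \<le> 1 / real K"
    using infdist_le[of "of_int p" \<int> t] assms by (auto simp: dist_real_def)
  then have "real K * infdist t \<int> \<le> real K * (1 / real K)"
    by (intro mult_left_mono) auto
  \<comment> \<open>An equality unless \<open>K = 0\<close>, where the left side is 0.\<close>
  also have "\<dots> \<le> 1"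
    by simp
  finally show ?thesis
    by (simp add: clamped_dist_def)
qed

lemma clamped_dist_less_1:
  assumes "0 < K" "clamped_dist K t < 1"
  obtains p :: int where "\<bar>t - of_int p\<bar> < 2 / real K"
proof -
  obtain z where z: "z \<in> (\<int> :: real set)" "infdist t \<int> = dist t z"
    by (rule infdist_attains_inf[of "\<int> :: real set" t]) auto
  then obtain p where p: "infdist t \<int> = \<bar>t - of_int p\<bar>"
    by (auto simp: dist_real_def elim!: Ints_cases)
  have "real K * infdist t \<int> < 2"
    using assms(2) by (auto simp: clamped_dist_def)
  then show thesis
    using that[of p] p assms(1) by (simp add: field_simps)
qed

text \<open>For nonzero \<open>x\<close> this is a composition of continuous maps. At
  \<open>x = 0\<close> the quotient is uncontrolled, but \<open>h\<close> lies between 0 and 1, so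
  the loss is squeezed by the absolute value of \<open>x\<close>.\<close>

lemma continuous_loss_loss: "continuous_loss (loss K)"
  unfolding continuous_loss_def continuous_on_def
proof
  fix p
  assume "p \<in> X \<times> Sigma_set"
  show "((\<lambda>(x, \<xi>). loss K x \<xi>) \<longlongrightarrow> (case p of (x, \<xi>) \<Rightarrow> loss K x \<xi>)) (at p within X \<times> Sigma_set)"
  proof (cases "fst p = 0")
    case True
    have "((\<lambda>q. loss K (fst q) (snd q)) \<longlongrightarrow> 0) (at p within X \<times> Sigma_set)"
    proof (rule Lim_null_comparison)
      show "\<forall>\<^sub>F q in at p within X \<times> Sigma_set. norm (loss K (fst q) (snd q)) \<le> \<bar>fst q\<bar>"
        using clamped_dist_nonneg clamped_dist_le_1
        by (intro always_eventually allI) (simp add: loss_def abs_mult mult_left_le)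
      have "((\<lambda>q. \<bar>fst q\<bar>) \<longlongrightarrow> \<bar>fst p\<bar>) (at p within X \<times> Sigma_set)"
        by (intro tendsto_intros)
      then show "((\<lambda>q. \<bar>fst q\<bar>) \<longlongrightarrow> 0) (at p within X \<times> Sigma_set)"
        using True by simp
    qed
    then show ?thesis
      using True by (simp add: case_prod_unfold loss_def)
  next
    case False
    have "isCont (clamped_dist K) (snd p / fst p)"
      using continuous_on_clamped_dist[of UNIV K] by (simp add: continuous_on_eq_continuous_at)
    then have "((\<lambda>q. fst q * clamped_dist K (snd q / fst q)) \<longlongrightarrow> fst p * clamped_dist K (snd p / fst p))
        (at p within X \<times> Sigma_set)"
      using False by (intro tendsto_mult isCont_tendsto_compose[of _ "clamped_dist K"] tendsto_intros)
    then show ?thesis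
      by (simp add: case_prod_unfold loss_def)
  qed
qed

section \<open>The true cost at \<open>x = 1 / q\<close>\<close>

lemma measure_P:
  assumes "A \<in> sets borel" "A \<subseteq> Sigma_set"
  shows "measure P A = measure lborel A / 2"
proof -
  let ?M = "restrict_space lborel Sigma_set"
  have sets: "A \<in> sets ?M" "Sigma_set \<in> sets ?M"
    using assms Sigma_set_borel by (auto simp: sets_restrict_space_iff)
  have "emeasure ?M Sigma_set = 2"
    using Sigma_set_borel by (subst emeasure_restrict_space) (auto simp: Sigma_set_def)
  moreover have "measure ?M B = measure lborel B" if "B \<subseteq> Sigma_set" for B
    using Sigma_set_borel that by (intro measure_restrict_space) auto
  ultimately show ?thesis
    using sets assms(2) unfolding P_def
    by (subst measure_uniform_measure) (auto simp: Int_absorb1 Sigma_set_def)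
qed

text \<open>The set is covered by \<open>2 * q + 3\<close> intervals of length
  \<open>4 / (K * q)\<close> around the points \<open>j / q\<close>. As
  \<open>2 * q + 3 \<le> 5 * q\<close>, their total length is at most \<open>20 / K\<close>, and the
  uniform density halves it. The bound must not depend on \<open>q\<close>, which will be chosen
  from the sample.\<close>

lemma measure_clamped_dist_less_1_le:
  assumes "2 \<le> K" "0 < q"
  shows "measure P {\<xi> \<in> Sigma_set. clamped_dist K (real q * \<xi>) < 1} \<le> 10 / real K"
    (is "measure P ?B \<le> _")
proof -
  let ?I = "{- int q - 1..int q + 1}"
  let ?C = "\<lambda>j::int. {of_int j / real q - 2 / (real K * real q)..of_int j / real q + 2 / (real K * real q)}"
  have B_meas: "?B \<in> sets lborel"
  proof -
    have "clamped_dist K \<in> borel_measurable borel"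
      by (intro borel_measurable_continuous_onI continuous_on_clamped_dist)
    then show ?thesis
      using Sigma_set_borel by measurable
  qed
  have "?B \<subseteq> (\<Union>j\<in>?I. ?C j)"
  proof
    fix \<xi>
    assume xi: "\<xi> \<in> ?B"
    then obtain p where p: "\<bar>real q * \<xi> - of_int p\<bar> < 2 / real K"
      using clamped_dist_less_1[of K "real q * \<xi>"] assms(1) by auto
    have "2 / real K \<le> 1"
      using assms(1) by simp
    moreover have "\<bar>real q * \<xi>\<bar> \<le> real q"
      using xi by (auto simp: Sigma_set_def abs_mult intro!: mult_left_le)
    ultimately have "\<bar>of_int p :: real\<bar> < real q + 1"
      using p by linarith
    then have "p \<in> ?I"
      by simp linarith
    moreover have "\<xi> \<in> ?C p"
      using p assms by (simp add: abs_less_iff field_simps)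
    ultimately show "\<xi> \<in> (\<Union>j\<in>?I. ?C j)"
      by blast
  qed
  then have "measure lborel ?B \<le> measure lborel (\<Union>j\<in>?I. ?C j)"
    using B_meas by (intro measure_mono_fmeasurable fmeasurable.finite_UN) (auto intro!: fmeasurableI)
  also have "\<dots> \<le> (\<Sum>j\<in>?I. measure lborel (?C j))"
    by (rule measure_UNION_le) auto
  also have "\<dots> = (2 * real q + 3) * (4 / (real K * real q))"
    by simp
  also have "\<dots> \<le> (5 * real q) * (4 / (real K * real q))"
    using assms by (intro mult_right_mono) auto
  also have "\<dots> = 20 / real K"
    using assms by simp
  finally show ?thesis
    using B_meas by (subst measure_P) auto
qed

text \<open>Bound \<open>h\<close> from below by the indicator of the set where it equals 1, whose
  complement has mass at most \<open>10 / K\<close>.\<close>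

lemma cost_loss_ge:
  assumes "2 \<le> K" "0 < q"
  shows "(1 - 10 / real K) / real q \<le> cost (loss K) (1 / real q) P"
proof -
  let ?B = "{\<xi> \<in> Sigma_set. clamped_dist K (real q * \<xi>) < 1}"
  have x: "1 / real q \<in> X"
    using assms(2) by (simp add: X_def)
  interpret prob_space P
    using P_in_prob_algebra by (simp add: space_prob_algebra)
  have sets: "sets P = sets borel_Sigma"
    using P_in_prob_algebra by (simp add: space_prob_algebra)
  then have space: "space P = Sigma_set"
    using sets_eq_imp_space_eq[OF sets] by (simp add: space_borel_Sigma)
  have h: "(\<lambda>\<xi>. clamped_dist K (real q * \<xi>)) \<in> borel_measurable P"
    unfolding measurable_cong_sets[OF sets refl] borel_Sigma_def
    by (intro borel_measurable_continuous_on_restrict continuous_on_compose2[OF continuous_on_clamped_dist[of UNIV]]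
        continuous_intros) auto
  have B: "?B \<in> sets P"
    using h unfolding space[symmetric] by measurable
  then have int_B: "integrable P (indicator ?B :: _ \<Rightarrow> real)"
    by (intro integrable_real_indicator) (auto simp: emeasure_eq_measure)
  have "1 - 10 / real K \<le> 1 - prob ?B"
    using measure_clamped_dist_less_1_le[OF assms] by simp
  also have "\<dots> = (\<integral>\<xi>. 1 - indicator ?B \<xi> \<partial>P)"
    using int_B prob_space sets.sets_into_space[OF B]
    by (subst Bochner_Integration.integral_diff) (auto simp: Int_absorb2)
  also have "\<dots> \<le> (\<integral>\<xi>. clamped_dist K (real q * \<xi>) \<partial>P)"
  proof (rule integral_mono)
    show "integrable P (\<lambda>\<xi>. clamped_dist K (real q * \<xi>))"
      using h clamped_dist_nonneg clamped_dist_le_1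
      by (intro integrable_const_bound[where B = 1]) auto
    show "1 - indicator ?B \<xi> \<le> clamped_dist K (real q * \<xi>)" if "\<xi> \<in> space P" for \<xi>
      using that clamped_dist_nonneg by (auto simp: indicator_def space not_less)
  qed (use int_B in auto)
  also have "\<dots> = real q * cost (loss K) (1 / real q) P"
    using assms(2) by (simp add: cost_def loss_def mult.commute)
  finally show ?thesis
    using assms(2) by (simp add: field_simps)
qed

section \<open>The predictor when the loss vanishes on the sample\<close>

text \<open>By \<open>exp_neg_le_measure_of_D_KL_le\<close> every \<open>Q\<close> in the ambiguity
  set gives mass at least \<open>exp (- r)\<close> to the zero set of \<open>l x\<close>. Only the
  remaining mass can contribute, and it pays at most \<open>b\<close>.\<close>

lemma cost_KL_le_of_null_loss:
  assumes l: "continuous_loss l" "x \<in> X" and Phat: "Phat \<in> space (prob_algebra borel_Sigma)" and "0 \<le> r"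
    and l_le: "\<And>\<xi>. \<xi> \<in> Sigma_set \<Longrightarrow> l x \<xi> \<le> b" and b: "0 \<le> b"
    and null: "measure Phat {\<xi> \<in> Sigma_set. l x \<xi> = 0} = 1"
  shows "cost_KL l r x Phat \<le> b * (1 - exp (- r))"
  unfolding cost_KL_def
proof (rule cSUP_least)
  let ?A = "{\<xi> \<in> Sigma_set. l x \<xi> = 0}"
  show "ambiguity_set r Phat \<noteq> {}"
    using self_in_ambiguity_set[OF Phat \<open>0 \<le> r\<close>] by auto
  fix Q
  assume "Q \<in> ambiguity_set r Phat"
  then have Q: "Q \<in> space (prob_algebra borel_Sigma)" and D: "D_KL Phat Q \<le> ereal r"
    by (auto simp: ambiguity_set_def)
  interpret prob_space Q
    using Q by (simp add: space_prob_algebra)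
  have sets: "sets Q = sets borel_Sigma" "sets Phat = sets Q" "prob_space Phat"
    using Q Phat by (auto simp: space_prob_algebra)
  have space: "space Q = Sigma_set"
    using sets_eq_imp_space_eq[OF sets(1)] by (simp add: space_borel_Sigma)
  have int: "integrable Q (l x)"
    by (rule integrable_loss[OF l Q])
  then have A: "?A \<in> sets Q"
    unfolding space[symmetric] by measurable
  then have int_A: "integrable Q (indicator ?A :: _ \<Rightarrow> real)"
    by (intro integrable_real_indicator) (auto simp: emeasure_eq_measure)
  have "cost l x Q \<le> (\<integral>\<xi>. b * (1 - indicator ?A \<xi>) \<partial>Q)"
    unfolding cost_def
  proof (rule integral_mono[OF int])
    show "integrable Q (\<lambda>\<xi>. b * (1 - indicator ?A \<xi>))"
      using int_A by auto
    show "l x \<xi> \<le> b * (1 - indicator ?A \<xi>)" if "\<xi> \<in> space Q" for \<xi>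
      using that l_le b by (auto simp: indicator_def space)
  qed
  also have "\<dots> = b * (1 - prob ?A)"
    using int_A prob_space sets.sets_into_space[OF A]
    by (subst integral_mult_right_zero, subst Bochner_Integration.integral_diff) (auto simp: Int_absorb2)
  also have "\<dots> \<le> b * (1 - exp (- r))"
    using exp_neg_le_measure_of_D_KL_le[OF sets(3) prob_space_axioms sets(2) D A null] b
    by (intro mult_left_mono) auto
  finally show "cost l x Q \<le> b * (1 - exp (- r))" .
qed

lemma measure_empirical_eq_1:
  assumes "1 \<le> N" "\<xi> \<in> space (sample_space N)" "A \<in> sets borel_Sigma"
    and "\<And>i. i \<in> {1..N} \<Longrightarrow> \<xi> i \<in> A"
  shows "measure (empirical N \<xi>) A = 1"
proof -
  have "emeasure (empirical N \<xi>) A = ennreal (1 / real N) * of_nat N"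
    using assms by (simp add: emeasure_empirical)
  also have "\<dots> = ennreal (1 / real N * real N)"
    by (simp add: ennreal_of_nat_eq_real_of_nat flip: ennreal_mult)
  also have "\<dots> = 1"
    using assms(1) by simp
  finally show ?thesis
    by (simp add: measure_def)
qed

section \<open>Disappointment by Dirichlet approximation\<close>

text \<open>The condition on \<open>K\<close> says \<open>10 / K < exp (- r)\<close>, so the lower
  bound \<open>(1 - 10 / K) / q\<close> for the true cost exceeds the upper bound
  \<open>(1 - exp (- r)) / q\<close> for the predictor. The common factor \<open>1 / q\<close> makes
  the comparison independent of how large \<open>q\<close> is.\<close>

lemma ex_cost_KL_less_cost:
  assumes K: "10 * exp r < real K" and "0 < r" "1 \<le> N" "\<xi> \<in> space (sample_space N)"
  shows "\<exists>x\<in>X. cost_KL (loss K) r x (empirical N \<xi>) < cost (loss K) x P"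
proof -
  have "1 < exp r"
    using \<open>0 < r\<close> by simp
  then have K2: "2 \<le> K"
    using K by linarith
  \<comment> \<open>\<open>Suc N\<close>, because the approximation theorem counts indices from 0
    and the sample from 1; coordinate 0 is simply carried along.\<close>
  obtain n p where n: "0 < n" "\<And>i. i < Suc N \<Longrightarrow> \<bar>of_int n * \<xi> i - of_int (p i)\<bar> < 1 / real K"
    using Dirichlet_approx_simult[of K "Suc N" \<xi>] K2 by (metis less_le_trans zero_less_numeral)
  define q where "q = nat n"
  have q: "0 < q" "of_int n = real q"
    using n(1) by (simp_all add: q_def)
  let ?x = "1 / real q"
  have x: "?x \<in> X"
    using q(1) by (simp add: X_def)
  note emp = empirical_in_prob_algebra[OF assms(3,4)]
  have range: "\<xi> i \<in> Sigma_set" if "i \<in> {1..N}" for i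
    using assms(4) that by (auto simp: space_sample_space)
  have "{\<zeta> \<in> Sigma_set. loss K ?x \<zeta> = 0} \<in> sets borel_Sigma"
  proof -
    have "loss K ?x \<in> borel_measurable borel_Sigma"
      unfolding borel_Sigma_def
      by (intro borel_measurable_continuous_on_restrict continuous_loss_section continuous_loss_loss x)
    then show ?thesis
      unfolding space_borel_Sigma[symmetric] by measurable
  qed
  moreover have "loss K ?x (\<xi> i) = 0" if "i \<in> {1..N}" for i
    using n(2)[of i] that clamped_dist_eq_0[of "real q * \<xi> i" "p i" K] q
    by (simp add: loss_def mult.commute)
  ultimately have null: "measure (empirical N \<xi>) {\<zeta> \<in> Sigma_set. loss K ?x \<zeta> = 0} = 1"
    using range by (intro measure_empirical_eq_1 assms) auto
  have "cost_KL (loss K) r ?x (empirical N \<xi>) \<le> ?x * (1 - exp (- r))"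
  proof (rule cost_KL_le_of_null_loss[OF continuous_loss_loss x emp _ _ _ null])
    show "loss K ?x \<zeta> \<le> ?x" for \<zeta>
      unfolding loss_def using q clamped_dist_le_1 by (intro mult_left_le) auto
  qed (use \<open>0 < r\<close> in auto)
  also have "\<dots> < (1 - 10 / real K) / real q"
  proof -
    have "10 / real K < exp (- r)"
      using K K2 by (simp add: exp_minus field_simps)
    then show ?thesis
      using q(1) by (simp add: divide_strict_right_mono)
  qed
  also have "\<dots> \<le> cost (loss K) ?x P"
    by (rule cost_loss_ge[OF K2 q(1)])
  finally show ?thesis
    using x by blast
qed

section \<open>Centering the loss by its true cost\<close>

definition centered :: "(real \<Rightarrow> real \<Rightarrow> real) \<Rightarrow> real \<Rightarrow> real \<Rightarrow> real" where
  "centered l x \<xi> = l x \<xi> - cost l x P"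

text \<open>Averaging over \<open>P\<close> preserves the modulus of continuity in \<open>x\<close>,
  which is uniform in the second argument by compactness.\<close>

lemma continuous_loss_centered:
  assumes "continuous_loss l"
  shows "continuous_loss (centered l)"
proof -
  have "continuous_on X (\<lambda>x. cost l x P)"
    unfolding continuous_on_iff
  proof (intro ballI allI impI)
    fix x e :: real
    assume x: "x \<in> X" and e: "0 < e"
    obtain d where d: "0 < d"
      "\<And>x y \<xi>. x \<in> X \<Longrightarrow> y \<in> X \<Longrightarrow> \<xi> \<in> Sigma_set \<Longrightarrow> dist x y < d \<Longrightarrow> l x \<xi> \<le> l y \<xi> + e / 2"
      using continuous_loss_equicontinuous[OF assms, of "e / 2"] e by (metis half_gt_zero)
    have "dist (cost l y P) (cost l x P) < e" if y: "y \<in> X" "dist y x < d" for y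
    proof -
      have "cost l x P \<le> cost l y P + e / 2" "cost l y P \<le> cost l x P + e / 2"
        using d(2) x y by (auto intro!: cost_diff_le assms P_in_prob_algebra simp: dist_commute)
      then show ?thesis
        using e by (simp add: dist_real_def abs_less_iff)
    qed
    with d(1) show "\<exists>d>0. \<forall>y\<in>X. dist y x < d \<longrightarrow> dist (cost l y P) (cost l x P) < e"
      by blast
  qed
  then have "continuous_on (X \<times> Sigma_set) (\<lambda>p. cost l (fst p) P)"
    by (rule continuous_on_compose2) (auto intro: continuous_intros)
  then show ?thesis
    using assms unfolding continuous_loss_def centered_def case_prod_unfold
    by (intro continuous_on_diff)
qed

lemma cost_centered:
  assumes "continuous_loss l" "x \<in> X" "Q \<in> space (prob_algebra borel_Sigma)"
  shows "cost (centered l) x Q = cost l x Q - cost l x P"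
proof -
  interpret prob_space Q
    using assms(3) by (simp add: space_prob_algebra)
  show ?thesis
    using integrable_loss[OF assms] prob_space
    by (simp add: cost_def[of "centered l"] centered_def cost_def[of l x Q])
qed

text \<open>The subtracted term is constant in the sample variable, so it lowers the cost under
  every probability \<open>Q\<close> by the same amount. This turns disappointment for
  \<open>l\<close> into negativity of the centered predictor.\<close>

lemma cost_KL_centered_le:
  assumes "continuous_loss l" "x \<in> X" "Phat \<in> space (prob_algebra borel_Sigma)" "0 \<le> r"
  shows "cost_KL (centered l) r x Phat \<le> cost_KL l r x Phat - cost l x P"
  unfolding cost_KL_def
proof (rule cSUP_least)
  show "ambiguity_set r Phat \<noteq> {}"
    using self_in_ambiguity_set[OF assms(3,4)] by auto
  fix Q
  assume Q: "Q \<in> ambiguity_set r Phat"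
  have "cost l x Q \<le> (SUP Q \<in> ambiguity_set r Phat. cost l x Q)"
    by (intro cSUP_upper bdd_above_costs assms Q)
  then show "cost (centered l) x Q \<le> (SUP Q \<in> ambiguity_set r Phat. cost l x Q) - cost l x P"
    using Q assms(1,2) by (simp add: cost_centered ambiguity_set_def)
qed

section \<open>Events of probability one and the two claims\<close>

lemma prob_space_sample_space: "prob_space (sample_space N)"
  unfolding sample_space_def
  by (intro prob_space_PiM) (use P_in_prob_algebra in \<open>simp add: space_prob_algebra\<close>)

text \<open>Disappointment is proved for every sample, so each event is the whole space and its
  measurability is immediate.\<close>

lemma measure_sample_space_eq_1:
  assumes "\<And>\<xi>. \<xi> \<in> space (sample_space N) \<Longrightarrow> A \<xi>"
  shows "measure (sample_space N) {\<xi> \<in> space (sample_space N). A \<xi>} = 1"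
proof -
  have "{\<xi> \<in> space (sample_space N). A \<xi>} = space (sample_space N)"
    using assms by auto
  then show ?thesis
    using prob_space.prob_space[OF prob_space_sample_space] by simp
qed

theorem theorem5p1:
  shows
    "(\<forall>r>0. \<exists>l. continuous_loss l \<and>
        (\<forall>N\<ge>1. measure (sample_space N)
            {\<xi> \<in> space (sample_space N). \<exists>x\<in>X. cost l x P > cost_KL l r x (empirical N \<xi>)} = 1))
     \<and>
     (\<exists>l. continuous_loss l \<and>
        (\<forall>r. 0 < r \<and> r < ln 2 \<longrightarrow> (\<forall>N\<ge>1.
          (\<forall>xhat :: real measure \<Rightarrow> real.
             (\<forall>\<xi>\<in>space (sample_space N).
                is_arg_min (\<lambda>x. cost_KL l r x (empirical N \<xi>)) (\<lambda>x. x \<in> X) (xhat (empirical N \<xi>)))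
             \<longrightarrow> measure (sample_space N)
                  {\<xi> \<in> space (sample_space N).
                     cost l (xhat (empirical N \<xi>)) P
                       > cost_KL l r (xhat (empirical N \<xi>)) (empirical N \<xi>)} = 1)
          \<and>
          measure (sample_space N)
            {\<xi> \<in> space (sample_space N).
               (INF x\<in>X. cost l x P) > (INF x\<in>X. cost_KL l r x (empirical N \<xi>))} = 1)))"
proof (intro conjI allI impI)
  fix r :: real
  assume r: "0 < r"
  obtain K :: nat where "10 * exp r < real K"
    using reals_Archimedean2 by blast
  then show "\<exists>l. continuous_loss l \<and>
        (\<forall>N\<ge>1. measure (sample_space N)
            {\<xi> \<in> space (sample_space N). \<exists>x\<in>X. cost l x P > cost_KL l r x (empirical N \<xi>)} = 1)"
    by (intro exI[of _ "loss K"] conjI continuous_loss_loss allI impI measure_sample_space_eq_1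
        ex_cost_KL_less_cost r)
next
  \<comment> \<open>\<open>K = 20\<close> serves all \<open>r < ln 2\<close> at once:
    \<open>exp r < 2\<close> gives \<open>10 * exp r < 20\<close>.\<close>
  let ?l = "centered (loss 20)"
  have l: "continuous_loss ?l"
    by (intro continuous_loss_centered continuous_loss_loss)
  have cost_0: "cost ?l x P = 0" if "x \<in> X" for x
    using cost_centered[OF continuous_loss_loss that P_in_prob_algebra] by simp
  have neg: "\<exists>x\<in>X. cost_KL ?l r x (empirical N \<xi>) < 0"
    if r: "0 < r" "r < ln 2" and N: "1 \<le> N" and xi: "\<xi> \<in> space (sample_space N)" for r N \<xi>
  proof -
    have "exp r < 2"
      using r(2) by (metis exp_less_cancel_iff exp_ln zero_less_numeral)
    then obtain x where x: "x \<in> X" "cost_KL (loss 20) r x (empirical N \<xi>) < cost (loss 20) x P"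
      using ex_cost_KL_less_cost[of r 20, OF _ r(1) N xi] by auto
    then show ?thesis
      using cost_KL_centered_le[OF continuous_loss_loss x(1) empirical_in_prob_algebra[OF N xi], of r 20] r(1)
      by (intro bexI[of _ x]) linarith+
  qed
  show "\<exists>l. continuous_loss l \<and>
        (\<forall>r. 0 < r \<and> r < ln 2 \<longrightarrow> (\<forall>N\<ge>1.
          (\<forall>xhat :: real measure \<Rightarrow> real.
             (\<forall>\<xi>\<in>space (sample_space N).
                is_arg_min (\<lambda>x. cost_KL l r x (empirical N \<xi>)) (\<lambda>x. x \<in> X) (xhat (empirical N \<xi>)))
             \<longrightarrow> measure (sample_space N)
                  {\<xi> \<in> space (sample_space N).
                     cost l (xhat (empirical N \<xi>)) P
                       > cost_KL l r (xhat (empirical N \<xi>)) (empirical N \<xi>)} = 1)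
          \<and>
          measure (sample_space N)
            {\<xi> \<in> space (sample_space N).
               (INF x\<in>X. cost l x P) > (INF x\<in>X. cost_KL l r x (empirical N \<xi>))} = 1))"
  proof (intro exI[of _ ?l] conjI allI impI l; elim conjE)
    fix r :: real and N :: nat and xhat :: "real measure \<Rightarrow> real"
    assume r: "0 < r" "r < ln 2" and N: "1 \<le> N"
      and xhat: "\<forall>\<xi>\<in>space (sample_space N).
        is_arg_min (\<lambda>x. cost_KL ?l r x (empirical N \<xi>)) (\<lambda>x. x \<in> X) (xhat (empirical N \<xi>))"
    show "measure (sample_space N) {\<xi> \<in> space (sample_space N). cost ?l (xhat (empirical N \<xi>)) P
        > cost_KL ?l r (xhat (empirical N \<xi>)) (empirical N \<xi>)} = 1"
    proof (rule measure_sample_space_eq_1)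
      fix \<xi>
      assume xi: "\<xi> \<in> space (sample_space N)"
      show "cost ?l (xhat (empirical N \<xi>)) P > cost_KL ?l r (xhat (empirical N \<xi>)) (empirical N \<xi>)"
        using neg[OF r N xi] bspec[OF xhat xi] cost_0
        by (fastforce simp: is_arg_min_def not_less)
    qed
  next
    fix r :: real and N :: nat
    assume r: "0 < r" "r < ln 2" and N: "1 \<le> N"
    show "measure (sample_space N) {\<xi> \<in> space (sample_space N).
        (INF x\<in>X. cost ?l x P) > (INF x\<in>X. cost_KL ?l r x (empirical N \<xi>))} = 1"
    proof (rule measure_sample_space_eq_1)
      fix \<xi>
      assume xi: "\<xi> \<in> space (sample_space N)"
      \<comment> \<open>Attainment makes the infimum a value of the predictor at a minimizer, hence
        at most the negative value provided by \<open>neg\<close>.\<close>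
      obtain y where y: "is_arg_min (\<lambda>x. cost_KL ?l r x (empirical N \<xi>)) (\<lambda>x. x \<in> X) y"
          "cost_KL ?l r y (empirical N \<xi>) = (INF x\<in>X. cost_KL ?l r x (empirical N \<xi>))"
        using ex_is_arg_min_cost_KL[OF l empirical_in_prob_algebra[OF N xi], of r] r(1) by auto
      have "cost_KL ?l r y (empirical N \<xi>) < 0"
        using neg[OF r N xi] y(1) by (fastforce simp: is_arg_min_def not_less)
      moreover have "(INF x\<in>X. cost ?l x P) = 0"
      proof -
        have "(INF x\<in>X. cost ?l x P) = (INF x\<in>X. 0)"
          by (rule INF_cong) (simp_all add: cost_0)
        then show ?thesis
          by (simp add: X_def)
      qed
      ultimately show "(INF x\<in>X. cost ?l x P) > (INF x\<in>X. cost_KL ?l r x (empirical N \<xi>))"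
        using y(2) by simp
    qed
  qed
qed

end
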